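(* Let $G$ be a group. (1) $P(G)'\leq G''$. (2) If $H/K$ is a section of $G$ (that is, $H$ is a subgroup of $G$ and $K$ is a normal subgroup of $H$) such that $[H,G']\leq K$, then $[H,P(G)]\leq K$. In particular, $C_G(G')\leq C_G(P(G))$ and $P(G)\leq C_G\big(Z_2(G)\big)$.
   Context: For a group $G$, the pseudocentre is $P(G)=\bigcap_{x\in G}C_G(x)^G$, where $C_G(x)$ is the centralizer of $x$ in $G$ and, for a subgroup $H\leq G$, $H^G$ is the normal closure of $H$ in $G$. $G'=[G,G]$ is the commutator subgroup, $G''=(G')'$, $[x,y]=x^{-1}y^{-1}xy$, and $[H,L]$ is the subgroup generated by all $[h,l]$ with $h\in H$, $l\in L$. $C_G(S)$ is the centralizer of $S$ in $G$, and $Z_2(G)$ is the second term of the upper central series of $G$. *)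

theory Defs
  imports "HOL-Algebra.Algebra"
begin

definition centralizer :: "('a, 'b) monoid_scheme \<Rightarrow> 'a set \<Rightarrow> 'a set" where
  "centralizer G S = {g \<in> carrier G. \<forall>s\<in>S. g \<otimes>\<^bsub>G\<^esub> s = s \<otimes>\<^bsub>G\<^esub> g}"

definition group_center :: "('a, 'b) monoid_scheme \<Rightarrow> 'a set" where
  "group_center G = centralizer G (carrier G)"

definition normal_closure :: "('a, 'b) monoid_scheme \<Rightarrow> 'a set \<Rightarrow> 'a set" where
  "normal_closure G H =
     generate G {inv\<^bsub>G\<^esub> g \<otimes>\<^bsub>G\<^esub> h \<otimes>\<^bsub>G\<^esub> g | g h. g \<in> carrier G \<and> h \<in> H}"

definition pseudocentre :: "('a, 'b) monoid_scheme \<Rightarrow> 'a set" where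
  "pseudocentre G = (\<Inter>x\<in>carrier G. normal_closure G (centralizer G {x}))"

definition commutator :: "('a, 'b) monoid_scheme \<Rightarrow> 'a \<Rightarrow> 'a \<Rightarrow> 'a" where
  "commutator G x y = inv\<^bsub>G\<^esub> x \<otimes>\<^bsub>G\<^esub> inv\<^bsub>G\<^esub> y \<otimes>\<^bsub>G\<^esub> x \<otimes>\<^bsub>G\<^esub> y"

definition commutator_subgroup :: "('a, 'b) monoid_scheme \<Rightarrow> 'a set \<Rightarrow> 'a set \<Rightarrow> 'a set" where
  "commutator_subgroup G H L = generate G {commutator G h l | h l. h \<in> H \<and> l \<in> L}"

text \<open>
  The library's \<^const>\<open>derived\<close> is generated by the elements \<open>x y x\<inverse> y\<inverse>\<close>; on subgroups it
  agrees with the convention \<open>[x, y] = x\<inverse> y\<inverse> x y\<close> used here.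
\<close>

lemma (in group) derived_eq_commutator_subgroup:
  assumes "subgroup H G"
  shows "derived G H = commutator_subgroup G H H"
proof -
  have "derived_set G H = {commutator G h l | h l. h \<in> H \<and> l \<in> H}" (is "?A = ?B")
  proof
    show "?A \<subseteq> ?B"
    proof
      fix z assume "z \<in> ?A"
      then obtain x y where xy: "x \<in> H" "y \<in> H" and z: "z = x \<otimes> y \<otimes> inv x \<otimes> inv y"
        by blast
      have "x \<in> carrier G" "y \<in> carrier G"
        using assms xy by (auto simp: subgroup.mem_carrier)
      then have "z = commutator G (inv x) (inv y)"
        by (simp add: z commutator_def)
      moreover have "inv x \<in> H" "inv y \<in> H"
        using assms xy by (auto simp: subgroup.m_inv_closed)
      ultimately show "z \<in> ?B" by blast
    qed
    show "?B \<subseteq> ?A"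
    proof
      fix z assume "z \<in> ?B"
      then obtain x y where xy: "x \<in> H" "y \<in> H" and z: "z = commutator G x y"
        by blast
      have "x \<in> carrier G" "y \<in> carrier G"
        using assms xy by (auto simp: subgroup.mem_carrier)
      then have "z = inv x \<otimes> inv y \<otimes> inv (inv x) \<otimes> inv (inv y)"
        by (simp add: z commutator_def)
      moreover have "inv x \<in> H" "inv y \<in> H"
        using assms xy by (auto simp: subgroup.m_inv_closed)
      ultimately show "z \<in> ?A" by blast
    qed
  qed
  then show ?thesis
    by (simp add: derived_def commutator_subgroup_def)
qed

text \<open>\<open>Z\<^sub>n\<^sub>+\<^sub>1(G)\<close> is the preimage in \<open>G\<close> of the centre of \<open>G / Z\<^sub>n(G)\<close>.\<close>

primrec upper_central :: "('a, 'b) monoid_scheme \<Rightarrow> nat \<Rightarrow> 'a set" where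
  "upper_central G 0 = {\<one>\<^bsub>G\<^esub>}"
| "upper_central G (Suc n) =
     {x \<in> carrier G. upper_central G n #>\<^bsub>G\<^esub> x \<in> group_center (G Mod upper_central G n)}"

end

theory Submission
  imports Defs
begin

text \<open>
  Since \<open>C\<^sub>G(x)\<^sup>G \<le> C\<^sub>G(x) G'\<close>, every \<open>p \<in> P(G)\<close> can be written, for each \<open>x\<close>, as \<open>p = c d\<close> with
  \<open>c\<close> centralizing \<open>x\<close> and \<open>d \<in> G'\<close>; hence \<open>[x, p] = [x, d]\<close>. All the claims about commutators with
  \<open>P(G)\<close> thereby reduce to commutators with \<open>G'\<close>. For (1) the replacement is made in both entries,
  and for the last claim \<open>[z, g]\<close> is a homomorphism in \<open>g\<close> to the centre when \<open>z \<in> Z\<^sub>2(G)\<close>, so it is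
  trivial on \<open>G'\<close>.
\<close>

section \<open>Centralizers and commutator identities\<close>

lemma centralizer_subset_carrier: "centralizer G S \<subseteq> carrier G"
  by (auto simp: centralizer_def)

context group
begin

lemma centralizer_is_subgroup:
  assumes "S \<subseteq> carrier G"
  shows "subgroup (centralizer G S) G"
proof (rule subgroupI)
  show "centralizer G S \<noteq> {}"
    using assms by (force simp: centralizer_def)
next
  fix a assume "a \<in> centralizer G S"
  then have a: "a \<in> carrier G" and comm: "\<And>s. s \<in> S \<Longrightarrow> a \<otimes> s = s \<otimes> a"
    by (auto simp: centralizer_def)
  have "inv a \<otimes> s = s \<otimes> inv a" if s: "s \<in> S" for s
  proof -
    have sc: "s \<in> carrier G" using assms s by blast
    then have "inv a \<otimes> s = inv a \<otimes> (s \<otimes> a) \<otimes> inv a"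
      using a by (simp add: m_assoc)
    also have "\<dots> = s \<otimes> inv a"
      using a sc by (simp add: comm[OF s, symmetric] m_assoc[symmetric])
    finally show ?thesis .
  qed
  then show "inv a \<in> centralizer G S"
    using a by (simp add: centralizer_def)
next
  fix a b assume "a \<in> centralizer G S" "b \<in> centralizer G S"
  then have ab: "a \<in> carrier G" "b \<in> carrier G"
    and comm: "\<And>s. s \<in> S \<Longrightarrow> a \<otimes> s = s \<otimes> a" "\<And>s. s \<in> S \<Longrightarrow> b \<otimes> s = s \<otimes> b"
    by (auto simp: centralizer_def)
  have "a \<otimes> b \<otimes> s = s \<otimes> (a \<otimes> b)" if s: "s \<in> S" for s
  proof -
    have sc: "s \<in> carrier G" using assms s by blast
    then have "a \<otimes> b \<otimes> s = a \<otimes> s \<otimes> b"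
      using ab by (simp add: m_assoc comm(2)[OF s])
    then show ?thesis
      using ab sc by (simp add: m_assoc comm(1)[OF s])
  qed
  then show "a \<otimes> b \<in> centralizer G S"
    using ab by (simp add: centralizer_def)
qed (simp add: centralizer_subset_carrier)

lemma commutator_eq_one_iff:
  assumes "x \<in> carrier G" "y \<in> carrier G"
  shows "commutator G x y = \<one> \<longleftrightarrow> x \<otimes> y = y \<otimes> x"
proof -
  have "commutator G x y = inv (y \<otimes> x) \<otimes> (x \<otimes> y)"
    using assms by (simp add: commutator_def inv_mult_group m_assoc)
  then show ?thesis
    using assms by (simp add: inv_solve_left')
qed

lemma inv_commutator:
  assumes "x \<in> carrier G" "y \<in> carrier G"
  shows "inv (commutator G x y) = commutator G y x"
  using assms by (simp add: commutator_def inv_mult_group m_assoc)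

text \<open>Conjugation by \<open>c\<close> fixes \<open>x\<close>, so
  \<open>inv c \<otimes> x \<otimes> c\<close> collapses to \<open>x\<close> in the middle of the
  commutator. This is what allows an element to be changed by a left factor from the centralizer of
  \<open>x\<close>.\<close>

lemma commutator_mult_right_centralizing:
  assumes "x \<in> carrier G" "c \<in> centralizer G {x}" "d \<in> carrier G"
  shows "commutator G x (c \<otimes> d) = commutator G x d"
proof -
  have c: "c \<in> carrier G" and "c \<otimes> x = x \<otimes> c"
    using assms by (auto simp: centralizer_def)
  then have "inv c \<otimes> (x \<otimes> (c \<otimes> d)) = x \<otimes> d"
    using assms by (simp add: inv_solve_left') (simp add: m_assoc[symmetric])
  then show ?thesis
    using assms c by (simp add: commutator_def inv_mult_group m_assoc)
qed

lemma commutator_in_derived: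
  assumes "subgroup H G" "x \<in> H" "y \<in> H"
  shows "commutator G x y \<in> derived G H"
  unfolding derived_eq_commutator_subgroup[OF assms(1)] commutator_subgroup_def
  using assms(2,3) by (auto intro: generate.incl)

section \<open>The pseudocentre modulo the derived subgroup\<close>

text \<open>A conjugate of \<open>h\<close> by \<open>g\<close> is \<open>h\<close> times the
  commutator [h, g], so every generator of the closure lies in H G'. That product is a subgroup
  because G' is normal.\<close>

lemma normal_closure_subset_mult_derived:
  assumes "subgroup H G"
  shows "normal_closure G H \<subseteq> H <#> derived G (carrier G)"
proof -
  interpret D: normal "derived G (carrier G)" G
    by (rule derived_is_normal[OF normal_self])
  have sub: "subgroup (H <#> derived G (carrier G)) G"
    using mult_norm_subgroup[OF D.normal_axioms assms] commut_normal[OF assms D.normal_axioms] by simp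
  have "inv g \<otimes> h \<otimes> g \<in> H <#> derived G (carrier G)" if g: "g \<in> carrier G" and h: "h \<in> H" for g h
  proof -
    have hc: "h \<in> carrier G" using assms h by (rule subgroup.mem_carrier)
    then have "inv g \<otimes> h \<otimes> g = h \<otimes> commutator G h g"
      using g by (simp add: commutator_def m_assoc[symmetric])
    then show ?thesis
      using h commutator_in_derived[OF subgroup_self hc g] by (auto simp: set_mult_def)
  qed
  then show ?thesis
    unfolding normal_closure_def by (intro generate_subgroup_incl[OF _ sub]) blast
qed

lemma pseudocentre_decomp:
  assumes "p \<in> pseudocentre G" "x \<in> carrier G"
  obtains c d where "c \<in> centralizer G {x}" "d \<in> derived G (carrier G)" "p = c \<otimes> d"
proof -
  have "subgroup (centralizer G {x}) G"
    using assms(2) by (simp add: centralizer_is_subgroup)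
  then have "normal_closure G (centralizer G {x}) \<subseteq> centralizer G {x} <#> derived G (carrier G)"
    by (rule normal_closure_subset_mult_derived)
  moreover have "p \<in> normal_closure G (centralizer G {x})"
    using assms by (simp add: pseudocentre_def)
  ultimately have "p \<in> centralizer G {x} <#> derived G (carrier G)" ..
  then show thesis
    using that by (auto simp: set_mult_def)
qed

lemma derived_carrier_closed: "d \<in> derived G (carrier G) \<Longrightarrow> d \<in> carrier G"
  using derived_in_carrier[of "carrier G"] by blast

lemma pseudocentre_in_carrier: "pseudocentre G \<subseteq> carrier G"
proof
  fix p assume "p \<in> pseudocentre G"
  \<comment> \<open>Any element of the group would serve as centralized element;
    \<open>\<one>\<close> is one that is always available.\<close>
  then obtain c d where "c \<in> centralizer G {\<one>}" "d \<in> derived G (carrier G)" "p = c \<otimes> d"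
    by (rule pseudocentre_decomp[OF _ one_closed])
  then show "p \<in> carrier G"
    by (simp add: derived_carrier_closed subsetD[OF centralizer_subset_carrier])
qed

text \<open>The form in which membership in P(G) is used from here on: inside a commutator with
  \<open>x\<close>, \<open>p\<close> may be traded for an element of G'. The choice of
  \<open>d\<close> depends on \<open>x\<close>.\<close>

lemma commutator_pseudocentre:
  assumes "p \<in> pseudocentre G" "x \<in> carrier G"
  obtains d where "d \<in> derived G (carrier G)" "commutator G x p = commutator G x d"
proof -
  obtain c d where "c \<in> centralizer G {x}" "d \<in> derived G (carrier G)" "p = c \<otimes> d"
    using pseudocentre_decomp[OF assms] .
  then show thesis
    using that commutator_mult_right_centralizing[OF assms(2)] derived_carrier_closed by simp
qed

lemma pseudocentre_is_subgroup: "subgroup (pseudocentre G) G"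
proof -
  have "subgroup (normal_closure G (centralizer G {x})) G" for x
    unfolding normal_closure_def using centralizer_subset_carrier[of G "{x}"]
    by (intro generate_is_subgroup) auto
  then show ?thesis
    unfolding pseudocentre_def by (intro subgroups_Inter) auto
qed

section \<open>Commutators with the pseudocentre\<close>

lemma derived_pseudocentre_subset:
  "derived G (pseudocentre G) \<subseteq> derived G (derived G (carrier G))"
proof -
  let ?D = "derived G (carrier G)"
  have D: "subgroup ?D G" by (rule derived_is_subgroup) simp
  have DD: "subgroup (derived G ?D) G"
    by (rule derived_is_subgroup) (simp add: derived_in_carrier)
  have "commutator G x y \<in> derived G ?D" if x: "x \<in> pseudocentre G" and y: "y \<in> pseudocentre G" for x y
  proof -
    have xc: "x \<in> carrier G" using x pseudocentre_in_carrier by blast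
    obtain d where d: "d \<in> ?D" "commutator G x y = commutator G x d"
      using commutator_pseudocentre[OF y xc] .
    have dc: "d \<in> carrier G" using d derived_carrier_closed by blast
    \<comment> \<open>The second replacement is made relative to \<open>d\<close>, not to
      \<open>y\<close>. Only right entries can be replaced, so \<open>x\<close> is moved to the
      right by passing to the inverse commutator.\<close>
    obtain e where e: "e \<in> ?D" "commutator G d x = commutator G d e"
      using commutator_pseudocentre[OF x dc] .
    have "commutator G x y = inv (commutator G d e)"
      using d e inv_commutator[OF dc xc] by simp
    then show ?thesis
      using subgroup.m_inv_closed[OF DD commutator_in_derived[OF D d(1) e(1)]] by simp
  qed
  then show ?thesis
    unfolding derived_eq_commutator_subgroup[OF pseudocentre_is_subgroup] commutator_subgroup_def
    by (intro generate_subgroup_incl[OF _ DD]) blast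
qed

text \<open>Each generator [h, p] equals some [h, d] with \<open>d\<close> in G', so the inclusion
  already holds between the generating sets.\<close>

lemma commutator_subgroup_pseudocentre_subset:
  assumes "H \<subseteq> carrier G"
  shows "commutator_subgroup G H (pseudocentre G) \<subseteq> commutator_subgroup G H (derived G (carrier G))"
  unfolding commutator_subgroup_def
proof (rule mono_generate, safe)
  fix h p assume h: "h \<in> H" and p: "p \<in> pseudocentre G"
  have "h \<in> carrier G" using assms h ..
  with p obtain d where "d \<in> derived G (carrier G)" "commutator G h p = commutator G h d"
    by (rule commutator_pseudocentre)
  then show "\<exists>h' l. commutator G h p = commutator G h' l \<and> h' \<in> H \<and> l \<in> derived G (carrier G)"
    using h by blast
qed

text \<open>Here [x, p] = [x, d] = 1 for a suitable \<open>d\<close> in G'. Stated for a single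
  \<open>x\<close>, it applies both to elements of C_G(G') and to elements of the second
  centre.\<close>

lemma pseudocentre_commute:
  assumes x: "x \<in> carrier G" and D: "\<And>d. d \<in> derived G (carrier G) \<Longrightarrow> x \<otimes> d = d \<otimes> x"
    and p: "p \<in> pseudocentre G"
  shows "x \<otimes> p = p \<otimes> x"
proof -
  obtain d where d: "d \<in> derived G (carrier G)" and eq: "commutator G x p = commutator G x d"
    using commutator_pseudocentre[OF p x] .
  have "commutator G x d = \<one>"
    using commutator_eq_one_iff[OF x derived_carrier_closed[OF d]] D[OF d] by simp
  then show ?thesis
    using commutator_eq_one_iff[OF x subsetD[OF pseudocentre_in_carrier p]] eq by simp
qed

section \<open>The first two terms of the upper central series\<close>

lemma group_centerD:
  assumes "u \<in> group_center G"
  shows "u \<in> carrier G" "g \<in> carrier G \<Longrightarrow> u \<otimes> g = g \<otimes> u"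
  using assms by (auto simp: group_center_def centralizer_def)

text \<open>Cosets of the trivial subgroup are singletons, and their set product is the singleton of
  the product, so the quotient is a copy of the group.\<close>

lemma upper_central_1: "upper_central G (Suc 0) = group_center G"
proof -
  have coset: "{\<one>} #> x = {x}" if "x \<in> carrier G" for x
    using that by (simp add: r_coset_def)
  have "{x} <#> {y} = {x \<otimes> y}" for x y
    by (simp add: set_mult_def)
  moreover have "carrier (G Mod {\<one>}) = (\<lambda>x. {x}) ` carrier G"
    using coset by (auto simp: FactGroup_def RCOSETS_def)
  ultimately show ?thesis
    using coset by (auto simp: group_center_def centralizer_def)
qed

text \<open>The element \<open>w\<close> is the commutator [z, g], which is central because the
  coset of \<open>z\<close> is central in the quotient by the centre.\<close>

lemma upper_central_2E:
  assumes z: "z \<in> upper_central G 2" and g: "g \<in> carrier G"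
  obtains w where "w \<in> group_center G" "z \<otimes> g = g \<otimes> z \<otimes> w"
proof -
  let ?U = "group_center G"
  have U: "subgroup ?U G"
    unfolding group_center_def by (rule centralizer_is_subgroup) simp
  have zc: "z \<in> carrier G" and "?U #> z \<in> group_center (G Mod ?U)"
    using z by (simp_all only: numeral_2_eq_2 upper_central.simps(2)[of G "Suc 0"] upper_central_1
        mem_Collect_eq)
  moreover have "?U #> g \<in> carrier (G Mod ?U)"
    using g by (auto simp: FactGroup_def RCOSETS_def)
  ultimately have eq: "(?U #> z) <#> (?U #> g) = (?U #> g) <#> (?U #> z)"
    by (auto simp: group_center_def centralizer_def)
  have "z \<otimes> g \<in> (?U #> z) <#> (?U #> g)"
    using rcos_self[OF zc U] rcos_self[OF g U] by (auto simp: set_mult_def)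
  \<comment> \<open>Multiplication in the quotient is the product of sets, so
    \<open>z \<otimes> g\<close> can be read off as a product of representatives in the opposite
    order. The central factors \<open>u\<close> and \<open>v\<close> are then collected on the
    right.\<close>
  then obtain u v where u: "u \<in> ?U" and v: "v \<in> ?U" and zg: "z \<otimes> g = (u \<otimes> g) \<otimes> (v \<otimes> z)"
    unfolding eq by (auto simp: set_mult_def r_coset_def)
  have "(u \<otimes> g) \<otimes> (v \<otimes> z) = g \<otimes> z \<otimes> (u \<otimes> v)"
  proof -
    have "(u \<otimes> g) \<otimes> (v \<otimes> z) = u \<otimes> (g \<otimes> z) \<otimes> v"
      using group_centerD(1)[OF u] group_centerD[OF v] g zc by (simp add: m_assoc)
    also have "\<dots> = (g \<otimes> z) \<otimes> u \<otimes> v"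
      using group_centerD(2)[OF u, of "g \<otimes> z"] g zc by simp
    finally show ?thesis
      using group_centerD(1)[OF u] group_centerD(1)[OF v] g zc by (simp add: m_assoc)
  qed
  then show thesis
    using that zg subgroup.m_closed[OF U u v] by metis
qed

lemma upper_central_2_commute_derived:
  assumes z: "z \<in> upper_central G 2" and d: "d \<in> derived G (carrier G)"
  shows "z \<otimes> d = d \<otimes> z"
proof -
  have zc: "z \<in> carrier G"
    using z by (simp add: numeral_2_eq_2)
  have "derived_set G (carrier G) \<subseteq> centralizer G {z}"
  proof clarify
    fix a b assume a: "a \<in> carrier G" and b: "b \<in> carrier G"
    obtain u where u: "u \<in> group_center G" and zu: "z \<otimes> a = a \<otimes> z \<otimes> u"
      using upper_central_2E[OF z a] .
    obtain v where v: "v \<in> group_center G" and zv: "z \<otimes> b = b \<otimes> z \<otimes> v"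
      using upper_central_2E[OF z b] .
    note uD = group_centerD[OF u] and vD = group_centerD[OF v]
    \<comment> \<open>Moving \<open>z\<close> past \<open>a\<close> and then \<open>b\<close> leaves
      the factors \<open>u\<close> and \<open>v\<close>. They are central, so the order
      \<open>b\<close>, \<open>a\<close> leaves the same total factor; comparing the two orders
      makes it cancel.\<close>
    have "z \<otimes> (a \<otimes> b) = a \<otimes> z \<otimes> (u \<otimes> b)"
      using a b zc uD(1) by (simp add: m_assoc[symmetric] zu)
    also have "\<dots> = a \<otimes> (z \<otimes> b) \<otimes> u"
      using a b zc uD by (simp add: m_assoc)
    also have "\<dots> = a \<otimes> b \<otimes> z \<otimes> (v \<otimes> u)"
      using a b zc uD(1) vD(1) by (simp add: m_assoc zv)
    finally have 1: "z \<otimes> (a \<otimes> b) = a \<otimes> b \<otimes> z \<otimes> (v \<otimes> u)" .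
    have "z \<otimes> (b \<otimes> a) = b \<otimes> z \<otimes> (v \<otimes> a)"
      using a b zc vD(1) by (simp add: m_assoc[symmetric] zv)
    also have "\<dots> = b \<otimes> (z \<otimes> a) \<otimes> v"
      using a b zc vD by (simp add: m_assoc)
    also have "\<dots> = b \<otimes> a \<otimes> z \<otimes> (u \<otimes> v)"
      using a b zc uD(1) vD(1) by (simp add: m_assoc zu)
    finally have 2: "z \<otimes> (b \<otimes> a) = b \<otimes> a \<otimes> z \<otimes> (v \<otimes> u)"
      using uD(1) vD(2) by simp
    \<comment> \<open>A generator in the library's convention, characterized by carrying
      \<open>b \<otimes> a\<close> to \<open>a \<otimes> b\<close>.\<close>
    define c where "c = a \<otimes> b \<otimes> inv a \<otimes> inv b"
    have cc: "c \<in> carrier G" and cba: "c \<otimes> (b \<otimes> a) = a \<otimes> b"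
      using a b by (auto simp: c_def m_assoc inv_solve_left')
    have "z \<otimes> c \<otimes> (b \<otimes> a) = c \<otimes> (b \<otimes> a) \<otimes> z \<otimes> (v \<otimes> u)"
      using 1 cc a b zc by (simp add: m_assoc[of z] cba)
    \<comment> \<open>Fact \<open>2\<close>, read from right to left, absorbs the central factor;
      cancelling \<open>b \<otimes> a\<close> then shows that \<open>z\<close> and \<open>c\<close>
      commute.\<close>
    also have "\<dots> = c \<otimes> z \<otimes> (b \<otimes> a)"
      using 2 cc a b zc uD(1) vD(1) by (simp add: m_assoc)
    finally have "z \<otimes> c = c \<otimes> z"
      using cc a b zc by simp
    then show "a \<otimes> b \<otimes> inv a \<otimes> inv b \<in> centralizer G {z}"
      using cc by (simp add: centralizer_def c_def)
  qed
  then have "derived G (carrier G) \<subseteq> centralizer G {z}"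
    unfolding derived_def
    by (rule generate_subgroup_incl) (simp add: centralizer_is_subgroup zc)
  then show ?thesis
    using d by (auto simp: centralizer_def)
qed

end

theorem theorem2p14:
  fixes G :: "('a, 'b) monoid_scheme" (structure)
  assumes "group G"
  shows "derived G (pseudocentre G) \<subseteq> derived G (derived G (carrier G))
    \<and> (\<forall>H K. subgroup H G \<longrightarrow> K \<lhd> G\<lparr>carrier := H\<rparr> \<longrightarrow>
          commutator_subgroup G H (derived G (carrier G)) \<subseteq> K \<longrightarrow>
          commutator_subgroup G H (pseudocentre G) \<subseteq> K)
    \<and> centralizer G (derived G (carrier G)) \<subseteq> centralizer G (pseudocentre G)
    \<and> pseudocentre G \<subseteq> centralizer G (upper_central G 2)"
proof -
  interpret group G by fact
  have "centralizer G (derived G (carrier G)) \<subseteq> centralizer G (pseudocentre G)"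
    using pseudocentre_commute by (auto simp: centralizer_def)
  moreover have "pseudocentre G \<subseteq> centralizer G (upper_central G 2)"
  proof
    fix p assume p: "p \<in> pseudocentre G"
    \<comment> \<open>The roles are exchanged: \<open>z\<close> commutes with G', hence with every
      element of P(G).\<close>
    have "p \<otimes> z = z \<otimes> p" if z: "z \<in> upper_central G 2" for z
    proof -
      have "z \<in> carrier G" using z by (simp add: numeral_2_eq_2)
      then show ?thesis
        using pseudocentre_commute[OF _ upper_central_2_commute_derived[OF z] p] by simp
    qed
    then show "p \<in> centralizer G (upper_central G 2)"
      using p pseudocentre_in_carrier by (auto simp: centralizer_def)
  qed
  moreover have "commutator_subgroup G H (pseudocentre G) \<subseteq> K"
    if "subgroup H G" "commutator_subgroup G H (derived G (carrier G)) \<subseteq> K" for H K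
    using commutator_subgroup_pseudocentre_subset[OF subgroup.subset[OF that(1)]] that(2)
    by (rule order_trans)
  ultimately show ?thesis
    using derived_pseudocentre_subset by simp
qed

end
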